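(* For $i=1,\dots,n$, let $Y_i=z_i^\top w+\varepsilon_i$ be observed, where $z_i=(\phi_i,A_i)\in\mathbb{R}^p$, $w=(\theta,\beta)\in\mathbb{R}^p$, and $\|z_i\|_2\le L$ almost surely. Let $\{\mathcal{F}_i\}_{i\ge 0}$ be a filtration such that $z_i$ is $\mathcal{F}_{i-1}$-measurable and the action $A_i$ is randomized or instrumented conditional on $\mathcal{F}_{i-1}$. Suppose the errors form a martingale difference sequence with $\mathbb{E}[\varepsilon_i\mid\mathcal{F}_{i-1}]=0$, $\mathrm{Var}(\varepsilon_i\mid\mathcal{F}_{i-1})=\sigma^2$, and $\varepsilon_i\mid\mathcal{F}_{i-1}$ is $\sigma^2$-sub-Gaussian. Let $G_n=n^{-1}\sum_{i=1}^n z_iz_i^\top$, let $\lambda>0$, and let $\mathcal{G}_\lambda=\{G_n\succeq\lambda I_p\}$ be the design event. Let $\hat w$ be the ordinary least squares estimator of $w$ and let $\delta\in(0,1)$. Conditional on the design event $\mathcal{G}_\lambda$, with probability at least $1-\delta$ over the regression noise, $$\|\hat w-w\|_2\le\frac{\sigma L}{\lambda}\sqrt{\frac{2p\log(2p/\delta)}{n}},$$ and, for any deployment policy with feature-action vector $z^\pi(H)$ satisfying $\|z^\pi(H)\|_2\le L$ almost surely, the induced conditional mean $z^\pi(H)^\top w$ is estimated uniformly up to $$\left|z^\pi(H)^\top(\hat w-w)\right|\le\epsilon_n,\qquad \epsilon_n:=\frac{\sigma L^2}{\lambda}\sqrt{\frac{2p\log(2p/\delta)}{n}}.$$ Suppose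 further that the oracle prediction error $|f(H)-z^\pi(H)^\top w|$ is bounded by $B$ almost surely. Then the plug-in squared-loss deployment-risk estimate $$\widehat R_m(f)=\mathbb{E}_H\!\left[(f(H)-z^\pi(H)^\top\hat w)^2\right]+\sigma^2$$ differs from the oracle deployment risk $R_m(f)=\mathbb{E}_H\!\left[(f(H)-z^\pi(H)^\top w)^2\right]+\sigma^2$ by at most $$\left|\widehat R_m(f)-R_m(f)\right|\le 2B\epsilon_n+\epsilon_n^2.$$
   Context: Here $\phi_i$ is a vector of (history-based) features, $A_i$ is the action, and $w=(\theta,\beta)$ is a fixed unknown parameter, $\beta$ being the feedback coefficient of the action. The variables $\varepsilon_i$ are adapted to $\{\mathcal{F}_i\}$. "$\varepsilon_i\mid\mathcal{F}_{i-1}$ is $\sigma^2$-sub-Gaussian" means $\mathbb{E}[e^{s\varepsilon_i}\mid\mathcal{F}_{i-1}]\le e^{s^2\sigma^2/2}$ almost surely for all $s\in\mathbb{R}$. "Randomized or instrumented" is an interpretive description of how $A_i$ is generated; its mathematical content is the stated measurability and martingale-difference conditions. $M\succeq N$ denotes the positive semidefinite order. On $\mathcal{G}_\lambda$, writing $Z\in\mathbb{R}^{n\times p}$ for the matrix with rows $z_i^\top$ and $Y=(Y_1,\dots,Y_n)^\top$, ordinary least squares is $\hat w=(Z^\top Z)^{-1}Z^\top Y$. $H$ denotes a history drawn from the law on which deployment is evaluated; $\mathbb{E}_H$ is expectation over $H$ only, with $\hat w$ held fixed. $f$ is a forecaster, a measurable real-valued function of the history. A deployment policy maps the history to an action, and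 $z^\pi(H)\in\mathbb{R}^p$ is the resulting vector of features and action. The outcome under deployment is $z^\pi(H)^\top w+\varepsilon$ where $\varepsilon$ has conditional mean $0$ and conditional variance $\sigma^2$ given $H$; the oracle deployment risk $R_m(f)$ at adoption share $m$ is the expected squared loss of $f(H)$ for this outcome, which equals $\mathbb{E}_H[(f(H)-z^\pi(H)^\top w)^2]+\sigma^2$.
   Formalization: For adaptive designs the literal conditional probability bound given the design event can fail; it is proved as "design event implies the bounds, with probability at least 1−δ", and as a conditional probability when the design event is F_0-measurable with positive probability. *)

theory Defs
  imports "HOL-Probability.Probability"
begin

text \<open>
  A vector \<open>(\<phi>, a)\<close> in \<open>\<real>\<^sup>p\<close>, with \<open>p = CARD('p)\<close>: coordinate \<open>act\<close> carries the action and the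
  other \<open>p - 1\<close> coordinates carry the features; the value \<open>\<phi> act\<close> is ignored.  Unlike the index
  type \<open>'d option\<close>, this also covers \<open>p = 1\<close>.
\<close>

definition feature_action :: "'p::finite \<Rightarrow> ('p \<Rightarrow> real) \<Rightarrow> real \<Rightarrow> real ^ 'p" where
  "feature_action act \<phi> a = (\<chi> j. if j = act then a else \<phi> j)"

definition outer_product :: "real ^ 'p \<Rightarrow> real ^ 'p ^ 'p" where
  "outer_product v = (\<chi> i j. v $ i * v $ j)"

definition gram :: "nat \<Rightarrow> (nat \<Rightarrow> real ^ 'p) \<Rightarrow> real ^ 'p ^ 'p" where
  "gram n z = (1 / real n) *\<^sub>R (\<Sum>i = 1..n. outer_product (z i))"

definition pos_semidef :: "real ^ 'p ^ 'p \<Rightarrow> bool" where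
  "pos_semidef S \<longleftrightarrow> transpose S = S \<and> (\<forall>v. 0 \<le> v \<bullet> (S *v v))"

definition loewner_ge :: "real ^ 'p ^ 'p \<Rightarrow> real ^ 'p ^ 'p \<Rightarrow> bool" where
  "loewner_ge S T \<longleftrightarrow> pos_semidef (S - T)"

text \<open>
  For the \<open>n \<times> p\<close> matrix \<open>Z\<close> with rows \<open>z\<^sub>1, \<dots>, z\<^sub>n\<close>, the matrix \<open>Z\<^sup>TZ\<close> is the sum of the outer products
  of the rows and \<open>Z\<^sup>TY\<close> is the sum of the \<open>Y\<^sub>i z\<^sub>i\<close>.  The value is meaningful only when \<open>Z\<^sup>TZ\<close> is
  invertible.
\<close>

definition ols :: "nat \<Rightarrow> (nat \<Rightarrow> real ^ 'p) \<Rightarrow> (nat \<Rightarrow> real) \<Rightarrow> real ^ 'p" where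
  "ols n z y = matrix_inv (\<Sum>i = 1..n. outer_product (z i)) *v (\<Sum>i = 1..n. y i *\<^sub>R z i)"

text \<open>
  Conditional expectations of nonnegative variables are taken in \<^typ>\<open>ennreal\<close>:
  \<^const>\<open>real_cond_exp\<close> is \<open>0\<close> wherever the conditional expectation is infinite, which would make an
  upper bound such as the sub-Gaussian one vacuous.
\<close>

definition cond_variance :: "'a measure \<Rightarrow> 'a measure \<Rightarrow> ('a \<Rightarrow> real) \<Rightarrow> 'a \<Rightarrow> ennreal" where
  "cond_variance M F X = nn_cond_exp M F (\<lambda>\<omega>. ennreal ((X \<omega> - real_cond_exp M F X \<omega>)\<^sup>2))"

definition cond_centered :: "'a measure \<Rightarrow> 'a measure \<Rightarrow> real \<Rightarrow> ('a \<Rightarrow> real) \<Rightarrow> bool" where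
  "cond_centered M F \<sigma> X \<longleftrightarrow> integrable M X
     \<and> (AE \<omega> in M. real_cond_exp M F X \<omega> = 0)
     \<and> (AE \<omega> in M. cond_variance M F X \<omega> = ennreal (\<sigma>\<^sup>2))"

definition cond_subgaussian :: "'a measure \<Rightarrow> 'a measure \<Rightarrow> real \<Rightarrow> ('a \<Rightarrow> real) \<Rightarrow> bool" where
  "cond_subgaussian M F \<sigma> X \<longleftrightarrow> (\<forall>s::real. AE \<omega> in M.
     nn_cond_exp M F (\<lambda>\<omega>. ennreal (exp (s * X \<omega>))) \<omega> \<le> ennreal (exp (s\<^sup>2 * \<sigma>\<^sup>2 / 2)))"

text \<open>
  \<open>D\<close> is the probability space of the deployment, \<open>H\<close> the random history with values in \<open>HS\<close>, \<open>\<xi>\<close> the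
  outcome noise and \<open>zp\<close> the feature-action vector of a policy.  The oracle risk is the expected squared
  loss for the outcome \<open>zp H \<bullet> w + \<xi>\<close>.
\<close>

definition oracle_risk ::
  "'b measure \<Rightarrow> ('b \<Rightarrow> 'h) \<Rightarrow> ('b \<Rightarrow> real) \<Rightarrow> ('h \<Rightarrow> real ^ 'p) \<Rightarrow> real ^ 'p \<Rightarrow> ('h \<Rightarrow> real) \<Rightarrow> real" where
  "oracle_risk D H \<xi> zp w f = (\<integral>\<omega>. (f (H \<omega>) - (zp (H \<omega>) \<bullet> w + \<xi> \<omega>))\<^sup>2 \<partial>D)"

definition mean_risk ::
  "'h measure \<Rightarrow> real \<Rightarrow> ('h \<Rightarrow> real ^ 'p) \<Rightarrow> real ^ 'p \<Rightarrow> ('h \<Rightarrow> real) \<Rightarrow> real" where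
  "mean_risk P\<^sub>H \<sigma> zp v f = (\<integral>h. (f h - zp h \<bullet> v)\<^sup>2 \<partial>P\<^sub>H) + \<sigma>\<^sup>2"

end

theory Submission
  imports Defs "HOL-Real_Asymp.Real_Asymp"
begin

text \<open>
  On the design event \<open>Z\<^sup>TZ\<close> has least eigenvalue at least \<open>n\<lambda>\<close>, so the error \<open>(Z\<^sup>TZ)\<^sup>-\<^sup>1 S\<close> of least
  squares, \<open>S\<close> being the sum of the \<open>\<epsilon>\<^sub>i z\<^sub>i\<close>, has norm at most \<open>norm S / (n\<lambda>)\<close>.  Each coordinate of
  \<open>S\<close> is a martingale with sub-Gaussian increments of variance proxy \<open>\<sigma>\<^sup>2L\<^sup>2\<close>, and a Chernoff bound at
  level \<open>\<delta>/p\<close> per coordinate, followed by a union bound, controls \<open>S\<close>.  Running the exponential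
  supermartingale on an arbitrary event of the initial \<open>\<sigma>\<close>-algebra gives the unconditional and the
  conditional claim at once.  The deployment claims then follow deterministically: by
  Cauchy--Schwarz, and by expanding the square around the oracle prediction error.
\<close>

section \<open>Sub-Gaussian noise with a predictable multiplier\<close>

lemma prob_space_sigma_finite_subalgebraI:
  "prob_space M \<Longrightarrow> subalgebra M F \<Longrightarrow> sigma_finite_subalgebra M F"
  by (intro finite_measure_subalgebra_is_sigma_finite)
    (auto simp: finite_measure_subalgebra_def finite_measure_subalgebra_axioms_def
      intro: prob_space.finite_measure)

text \<open>A simple \<open>U\<close> is constant on each of finitely many events of
  \<open>F\<close>, and there the hypothesis applies with that constant as \<open>s\<close>. The
  \<open>F\<close>-measurable weight \<open>g\<close> later holds the past of the
  martingale.\<close>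

lemma nn_integral_exp_simple_multiplier_le:
  assumes sf: "sigma_finite_subalgebra M F"
    and X[measurable]: "X \<in> borel_measurable M"
    and sub: "cond_subgaussian M F \<sigma> X"
    and U: "simple_function F U"
    and g[measurable]: "g \<in> borel_measurable F"
  shows "(\<integral>\<^sup>+\<omega>. g \<omega> * ennreal (exp (U \<omega> * X \<omega> - (U \<omega>)\<^sup>2 * \<sigma>\<^sup>2 / 2)) \<partial>M) \<le> (\<integral>\<^sup>+\<omega>. g \<omega> \<partial>M)"
proof -
  interpret sigma_finite_subalgebra M F by fact
  have sp: "space F = space M" using subalg by (simp add: subalgebra_def)
  have [measurable]: "g \<in> borel_measurable M" by (rule measurable_from_subalg[OF subalg g])
  define R where "R = U ` space F"
  have fin: "finite R" using U by (simp add: simple_function_def R_def)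
  define I where "I u \<omega> = (indicator (U -` {u} \<inter> space F) \<omega> :: ennreal)" for u \<omega>
  have IF[measurable]: "I u \<in> borel_measurable F" for u
    unfolding I_def using simple_functionD(2)[OF U] by measurable
  have [measurable]: "I u \<in> borel_measurable M" for u by (rule measurable_from_subalg[OF subalg IF])
  \<comment> \<open>Applied with the exponential to freeze \<open>U\<close> at a constant on each
    piece, and at the end with \<open>h = 1\<close> to put \<open>g\<close> together again.\<close>
  have split: "h (U \<omega>) = (\<Sum>u\<in>R. I u \<omega> * h u)" if "\<omega> \<in> space M" for \<omega> and h :: "real \<Rightarrow> ennreal"
  proof -
    have "(\<Sum>u\<in>R. I u \<omega> * h u) = (\<Sum>u\<in>R. if u = U \<omega> then h u else 0)"
      using that sp by (intro sum.cong) (auto simp: I_def indicator_def)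
    also have "\<dots> = h (U \<omega>)" using that sp fin by (simp add: R_def)
    finally show ?thesis ..
  qed
  have "(\<integral>\<^sup>+\<omega>. g \<omega> * ennreal (exp (U \<omega> * X \<omega> - (U \<omega>)\<^sup>2 * \<sigma>\<^sup>2 / 2)) \<partial>M)
      = (\<integral>\<^sup>+\<omega>. (\<Sum>u\<in>R. (g \<omega> * I u \<omega> * ennreal (exp (- (u\<^sup>2 * \<sigma>\<^sup>2 / 2)))) * ennreal (exp (u * X \<omega>))) \<partial>M)"
  proof (rule nn_integral_cong)
    fix \<omega> assume "\<omega> \<in> space M"
    from split[OF this, of "\<lambda>u. ennreal (exp (u * X \<omega> - u\<^sup>2 * \<sigma>\<^sup>2 / 2))"]
    show "g \<omega> * ennreal (exp (U \<omega> * X \<omega> - (U \<omega>)\<^sup>2 * \<sigma>\<^sup>2 / 2)) =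
        (\<Sum>u\<in>R. (g \<omega> * I u \<omega> * ennreal (exp (- (u\<^sup>2 * \<sigma>\<^sup>2 / 2)))) * ennreal (exp (u * X \<omega>)))"
      by (simp add: sum_distrib_left mult.assoc flip: ennreal_mult exp_add)
  qed
  also have "\<dots> = (\<Sum>u\<in>R. \<integral>\<^sup>+\<omega>. (g \<omega> * I u \<omega> * ennreal (exp (- (u\<^sup>2 * \<sigma>\<^sup>2 / 2)))) * ennreal (exp (u * X \<omega>)) \<partial>M)"
    by (rule nn_integral_sum) measurable
  also have "\<dots> \<le> (\<Sum>u\<in>R. \<integral>\<^sup>+\<omega>. g \<omega> * I u \<omega> \<partial>M)"
  proof (rule sum_mono)
    \<comment> \<open>All factors except \<open>exp (u * X \<omega>)\<close> are
      \<open>F\<close>-measurable, so this one may be replaced by its conditional expectation, whose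
      bound is cancelled exactly by the compensator.\<close>
    fix u
    have "(\<integral>\<^sup>+\<omega>. (g \<omega> * I u \<omega> * ennreal (exp (- (u\<^sup>2 * \<sigma>\<^sup>2 / 2)))) * ennreal (exp (u * X \<omega>)) \<partial>M)
       = (\<integral>\<^sup>+\<omega>. (g \<omega> * I u \<omega> * ennreal (exp (- (u\<^sup>2 * \<sigma>\<^sup>2 / 2)))) *
            nn_cond_exp M F (\<lambda>\<omega>. ennreal (exp (u * X \<omega>))) \<omega> \<partial>M)"
      by (rule nn_cond_exp_intg[symmetric]) measurable
    also have "\<dots> \<le> (\<integral>\<^sup>+\<omega>. g \<omega> * I u \<omega> \<partial>M)"
    proof (rule nn_integral_mono_AE)
      have "AE \<omega> in M. nn_cond_exp M F (\<lambda>\<omega>. ennreal (exp (u * X \<omega>))) \<omega> \<le> ennreal (exp (u\<^sup>2 * \<sigma>\<^sup>2 / 2))"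
        using sub by (simp add: cond_subgaussian_def)
      then show "AE \<omega> in M. (g \<omega> * I u \<omega> * ennreal (exp (- (u\<^sup>2 * \<sigma>\<^sup>2 / 2)))) *
            nn_cond_exp M F (\<lambda>\<omega>. ennreal (exp (u * X \<omega>))) \<omega> \<le> g \<omega> * I u \<omega>"
      proof eventually_elim
        case (elim \<omega>)
        have "(g \<omega> * I u \<omega> * ennreal (exp (- (u\<^sup>2 * \<sigma>\<^sup>2 / 2)))) *
            nn_cond_exp M F (\<lambda>\<omega>. ennreal (exp (u * X \<omega>))) \<omega>
            \<le> (g \<omega> * I u \<omega> * ennreal (exp (- (u\<^sup>2 * \<sigma>\<^sup>2 / 2)))) * ennreal (exp (u\<^sup>2 * \<sigma>\<^sup>2 / 2))"
          by (rule mult_left_mono[OF elim]) simp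
        also have "\<dots> = g \<omega> * I u \<omega>"
          by (simp add: mult.assoc flip: ennreal_mult exp_add)
        finally show ?case .
      qed
    qed
    finally show "(\<integral>\<^sup>+\<omega>. (g \<omega> * I u \<omega> * ennreal (exp (- (u\<^sup>2 * \<sigma>\<^sup>2 / 2)))) * ennreal (exp (u * X \<omega>)) \<partial>M)
      \<le> (\<integral>\<^sup>+\<omega>. g \<omega> * I u \<omega> \<partial>M)" .
  qed
  also have "\<dots> = (\<integral>\<^sup>+\<omega>. (\<Sum>u\<in>R. g \<omega> * I u \<omega>) \<partial>M)"
    by (rule nn_integral_sum[symmetric]) measurable
  also have "\<dots> = (\<integral>\<^sup>+\<omega>. g \<omega> \<partial>M)"
  proof (rule nn_integral_cong)
    fix \<omega> assume "\<omega> \<in> space M"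
    from split[OF this, of "\<lambda>_. 1"] show "(\<Sum>u\<in>R. g \<omega> * I u \<omega>) = g \<omega>"
      by (simp flip: sum_distrib_left)
  qed
  finally show ?thesis .
qed

text \<open>
  The hypothesis bounds the conditional moment generating function only for each constant \<open>s\<close>.
  Moving the compensator \<open>U\<^sup>2\<sigma>\<^sup>2/2\<close> into the exponent makes the bound for simple \<open>U\<close> free of \<open>U\<close>,
  so that Fatou's lemma alone carries it over to the limit.
\<close>

lemma nn_integral_exp_multiplier_le:
  assumes sf: "sigma_finite_subalgebra M F"
    and X[measurable]: "X \<in> borel_measurable M"
    and sub: "cond_subgaussian M F \<sigma> X"
    and U: "U \<in> borel_measurable F"
    and g[measurable]: "g \<in> borel_measurable F"
  shows "(\<integral>\<^sup>+\<omega>. g \<omega> * ennreal (exp (U \<omega> * X \<omega> - (U \<omega>)\<^sup>2 * \<sigma>\<^sup>2 / 2)) \<partial>M) \<le> (\<integral>\<^sup>+\<omega>. g \<omega> \<partial>M)"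
proof -
  interpret sigma_finite_subalgebra M F by fact
  have sp: "space F = space M" using subalg by (simp add: subalgebra_def)
  have [measurable]: "g \<in> borel_measurable M" by (rule measurable_from_subalg[OF subalg g])
  obtain s where s: "\<And>i. simple_function F (s i)" "\<And>x. x \<in> space F \<Longrightarrow> (\<lambda>i. s i x) \<longlonglongrightarrow> U x"
    using borel_measurable_implies_sequence_metric[OF U, of 0] by blast
  have [measurable]: "s i \<in> borel_measurable M" for i
    by (rule measurable_from_subalg[OF subalg borel_measurable_simple_function[OF s(1)]])
  let ?h = "\<lambda>u \<omega>. ennreal (exp (u * X \<omega> - u\<^sup>2 * \<sigma>\<^sup>2 / 2))"
  have "(\<integral>\<^sup>+\<omega>. g \<omega> * ?h (U \<omega>) \<omega> \<partial>M) \<le> (\<integral>\<^sup>+\<omega>. liminf (\<lambda>i. g \<omega> * ?h (s i \<omega>) \<omega>) \<partial>M)"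
  proof (rule nn_integral_mono)
    fix \<omega> assume "\<omega> \<in> space M"
    then have l: "(\<lambda>i. s i \<omega>) \<longlonglongrightarrow> U \<omega>" using s sp by simp
    have "(\<lambda>i. g \<omega> * ?h (s i \<omega>) \<omega>) \<longlonglongrightarrow> g \<omega> * ?h (U \<omega>) \<omega>"
      by (intro tendsto_mult_ennreal tendsto_const tendsto_ennrealI tendsto_exp tendsto_diff
          tendsto_mult tendsto_divide tendsto_power l) auto
    then show "g \<omega> * ?h (U \<omega>) \<omega> \<le> liminf (\<lambda>i. g \<omega> * ?h (s i \<omega>) \<omega>)"
      by (simp add: lim_imp_Liminf)
  qed
  also have "\<dots> \<le> liminf (\<lambda>i. \<integral>\<^sup>+\<omega>. g \<omega> * ?h (s i \<omega>) \<omega> \<partial>M)"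
    by (rule nn_integral_liminf) measurable
  also have "\<dots> \<le> liminf (\<lambda>i. \<integral>\<^sup>+\<omega>. g \<omega> \<partial>M)"
    by (intro Liminf_mono always_eventually allI nn_integral_exp_simple_multiplier_le[OF sf X sub s(1) g])
  also have "\<dots> = (\<integral>\<^sup>+\<omega>. g \<omega> \<partial>M)"
    by (simp add: Liminf_const)
  finally show ?thesis .
qed

text \<open>Induction on \<open>k\<close>: given \<open>F k\<close>, the new factor costs at most
  \<open>exp (s\<^sup>2 * (\<sigma>\<^sup>2 * L\<^sup>2) / 2)\<close>. The event \<open>E\<close>
  lies in every \<open>F k\<close>, so its indicator travels with the past and
  \<open>emeasure M E\<close> survives on the right.\<close>

lemma nn_integral_exp_predictable_sum_le:
  fixes x X :: "nat \<Rightarrow> 'a \<Rightarrow> real"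
  assumes M: "prob_space M" and filt: "filtration (space M) F" and subF: "\<And>i. subalgebra M (F i)"
    and bound: "\<And>i. i \<in> {1..n} \<Longrightarrow> AE \<omega> in M. \<bar>x i \<omega>\<bar> \<le> L"
    and x: "\<And>i. i \<in> {1..n} \<Longrightarrow> x i \<in> borel_measurable (F (i - 1))"
    and X: "\<And>i. i \<in> {1..n} \<Longrightarrow> X i \<in> borel_measurable (F i)"
    and sub: "\<And>i. i \<in> {1..n} \<Longrightarrow> cond_subgaussian M (F (i - 1)) \<sigma> (X i)"
    and E: "E \<in> sets (F 0)"
  shows "k \<le> n \<Longrightarrow> (\<integral>\<^sup>+\<omega>. indicator E \<omega> * ennreal (exp (s * (\<Sum>i = 1..k. x i \<omega> * X i \<omega>))) \<partial>M)
      \<le> ennreal (exp (s\<^sup>2 * (real k * (\<sigma>\<^sup>2 * L\<^sup>2)) / 2)) * emeasure M E"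
proof (induction k)
  case 0
  have "E \<in> sets M" using subF[of 0] E by (auto simp: subalgebra_def)
  then show ?case by simp
next
  case (Suc k)
  have FM: "f \<in> borel_measurable M" if "f \<in> borel_measurable (F i)" for i and f :: "'a \<Rightarrow> real"
    by (rule measurable_from_subalg[OF subF that])
  have Fmono: "f \<in> borel_measurable (F j)" if "f \<in> borel_measurable (F i)" "i \<le> j"
    for i j and f :: "'a \<Rightarrow> real"
    using filtration.sets_F_mono[OF filt that(2)] filtration.space_F[OF filt]
    by (intro measurable_from_subalg[OF _ that(1)]) (simp add: subalgebra_def)
  have SF: "(\<lambda>\<omega>. \<Sum>i = 1..k. x i \<omega> * X i \<omega>) \<in> borel_measurable (F k)"
    using Suc.prems by (intro borel_measurable_sum borel_measurable_times Fmono[OF x] Fmono[OF X]) auto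
  have xF: "x (Suc k) \<in> borel_measurable (F k)" using x[of "Suc k"] Suc.prems by simp
  have EF: "E \<in> sets (F k)" using filtration.sets_F_mono[OF filt, of 0 k] E by auto
  have EM: "E \<in> sets M" using subF[of k] EF by (auto simp: subalgebra_def)
  have XM[measurable]: "X (Suc k) \<in> borel_measurable M" using FM[OF X] Suc.prems by auto
  note [measurable] = FM[OF xF] FM[OF SF]
  \<comment> \<open>An almost sure upper bound for the compensator
    \<open>(U \<omega>)\<^sup>2 * \<sigma>\<^sup>2 / 2\<close> of one step; it pays for subtracting
    the compensator in the exponent.\<close>
  define c where "c = s\<^sup>2 * (\<sigma>\<^sup>2 * L\<^sup>2) / 2"
  define g where "g \<omega> = (indicator E \<omega> * ennreal (exp (s * (\<Sum>i = 1..k. x i \<omega> * X i \<omega>))) :: ennreal)" for \<omega>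
  have gF: "g \<in> borel_measurable (F k)" unfolding g_def using SF EF by measurable
  have gM[measurable]: "g \<in> borel_measurable M" by (rule measurable_from_subalg[OF subF gF])
  define U where "U = (\<lambda>\<omega>. s * x (Suc k) \<omega>)"
  have UF: "U \<in> borel_measurable (F k)" unfolding U_def using xF by measurable
  have UM[measurable]: "U \<in> borel_measurable M" by (rule FM[OF UF])
  have "(\<integral>\<^sup>+\<omega>. indicator E \<omega> * ennreal (exp (s * (\<Sum>i = 1..Suc k. x i \<omega> * X i \<omega>))) \<partial>M)
      \<le> (\<integral>\<^sup>+\<omega>. ennreal (exp c) * (g \<omega> * ennreal (exp (U \<omega> * X (Suc k) \<omega> - (U \<omega>)\<^sup>2 * \<sigma>\<^sup>2 / 2))) \<partial>M)"
  proof (rule nn_integral_mono_AE)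
    have "AE \<omega> in M. \<bar>x (Suc k) \<omega>\<bar> \<le> L" using bound[of "Suc k"] Suc.prems by simp
    then show "AE \<omega> in M. indicator E \<omega> * ennreal (exp (s * (\<Sum>i = 1..Suc k. x i \<omega> * X i \<omega>)))
      \<le> ennreal (exp c) * (g \<omega> * ennreal (exp (U \<omega> * X (Suc k) \<omega> - (U \<omega>)\<^sup>2 * \<sigma>\<^sup>2 / 2)))"
    proof eventually_elim
      case (elim \<omega>)
      have "(x (Suc k) \<omega>)\<^sup>2 \<le> L\<^sup>2" using elim by (metis abs_ge_zero power2_abs power_mono)
      then have "s\<^sup>2 * \<sigma>\<^sup>2 * (x (Suc k) \<omega>)\<^sup>2 \<le> s\<^sup>2 * \<sigma>\<^sup>2 * L\<^sup>2" by (intro mult_left_mono) auto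
      then have "exp (s * (\<Sum>i = 1..Suc k. x i \<omega> * X i \<omega>))
        \<le> exp c * (exp (s * (\<Sum>i = 1..k. x i \<omega> * X i \<omega>)) * exp (U \<omega> * X (Suc k) \<omega> - (U \<omega>)\<^sup>2 * \<sigma>\<^sup>2 / 2))"
        by (simp add: U_def c_def algebra_simps power_mult_distrib flip: exp_add)
      then have "ennreal (exp (s * (\<Sum>i = 1..Suc k. x i \<omega> * X i \<omega>)))
        \<le> ennreal (exp c) * (ennreal (exp (s * (\<Sum>i = 1..k. x i \<omega> * X i \<omega>)))
           * ennreal (exp (U \<omega> * X (Suc k) \<omega> - (U \<omega>)\<^sup>2 * \<sigma>\<^sup>2 / 2)))"
        by (simp flip: ennreal_mult)
      then show ?case unfolding g_def by (auto simp: indicator_def)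
    qed
  qed
  also have "\<dots> = ennreal (exp c) * (\<integral>\<^sup>+\<omega>. g \<omega> * ennreal (exp (U \<omega> * X (Suc k) \<omega> - (U \<omega>)\<^sup>2 * \<sigma>\<^sup>2 / 2)) \<partial>M)"
    by (rule nn_integral_cmult) measurable
  also have "\<dots> \<le> ennreal (exp c) * (\<integral>\<^sup>+\<omega>. g \<omega> \<partial>M)"
    using sub[of "Suc k"] Suc.prems
    by (intro mult_left_mono nn_integral_exp_multiplier_le[OF prob_space_sigma_finite_subalgebraI[OF M subF] XM _ UF gF]) auto
  also have "\<dots> \<le> ennreal (exp c) * (ennreal (exp (s\<^sup>2 * (real k * (\<sigma>\<^sup>2 * L\<^sup>2)) / 2)) * emeasure M E)"
    unfolding g_def using Suc by (intro mult_left_mono) auto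
  also have "\<dots> = ennreal (exp (s\<^sup>2 * (real (Suc k) * (\<sigma>\<^sup>2 * L\<^sup>2)) / 2)) * emeasure M E"
    unfolding c_def mult.assoc[symmetric]
    by (simp flip: ennreal_mult exp_add) (simp add: algebra_simps add_divide_distrib)
  finally show ?case .
qed

section \<open>Tail bounds on an event\<close>

text \<open>Markov's inequality for \<open>exp (s * S \<omega>)\<close> restricted to
  \<open>E\<close>. The parameter \<open>s\<close> stays free because for \<open>V = 0\<close> and
  \<open>t > 0\<close> no best choice exists.\<close>

lemma chernoff_on_event:
  assumes M: "prob_space M" and S[measurable]: "S \<in> borel_measurable M" and E[measurable]: "E \<in> sets M"
    and mgf: "(\<integral>\<^sup>+\<omega>. indicator E \<omega> * ennreal (exp (s * S \<omega>)) \<partial>M) \<le> ennreal (exp (s\<^sup>2 * V / 2)) * emeasure M E"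
    and s: "s \<ge> 0"
  shows "measure M {\<omega> \<in> space M. \<omega> \<in> E \<and> t \<le> S \<omega>} \<le> exp (s\<^sup>2 * V / 2 - s * t) * measure M E"
proof -
  interpret prob_space M by fact
  have "emeasure M {\<omega> \<in> space M. \<omega> \<in> E \<and> t \<le> S \<omega>}
      = (\<integral>\<^sup>+\<omega>. indicator {\<omega> \<in> space M. \<omega> \<in> E \<and> t \<le> S \<omega>} \<omega> \<partial>M)" by simp
  also have "\<dots> \<le> (\<integral>\<^sup>+\<omega>. ennreal (exp (- s * t)) * (indicator E \<omega> * ennreal (exp (s * S \<omega>))) \<partial>M)"
  proof (rule nn_integral_mono)
    fix \<omega>
    have "1 \<le> exp (- s * t) * exp (s * S \<omega>)" if "t \<le> S \<omega>"
      using mult_left_mono[OF that s] by (simp flip: exp_add)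
    then have "1 \<le> ennreal (exp (- s * t)) * ennreal (exp (s * S \<omega>))" if "t \<le> S \<omega>"
      using that by (simp flip: ennreal_mult)
    then show "indicator {\<omega> \<in> space M. \<omega> \<in> E \<and> t \<le> S \<omega>} \<omega>
      \<le> ennreal (exp (- s * t)) * (indicator E \<omega> * ennreal (exp (s * S \<omega>)))"
      by (auto simp: indicator_def)
  qed
  also have "\<dots> = ennreal (exp (- s * t)) * (\<integral>\<^sup>+\<omega>. indicator E \<omega> * ennreal (exp (s * S \<omega>)) \<partial>M)"
    by (rule nn_integral_cmult) measurable
  also have "\<dots> \<le> ennreal (exp (- s * t)) * (ennreal (exp (s\<^sup>2 * V / 2)) * emeasure M E)"
    by (rule mult_left_mono[OF mgf]) simp
  also have "\<dots> = ennreal (exp (s\<^sup>2 * V / 2 - s * t) * measure M E)"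
    by (simp add: emeasure_eq_measure flip: ennreal_mult mult.assoc exp_add)
  finally show ?thesis
    by (simp add: emeasure_eq_measure)
qed

text \<open>The strict inequality in the event matters for \<open>V = 0\<close>: the threshold is
  then \<open>0\<close>, and the bound rests on \<open>S \<omega> \<le> 0\<close> holding almost
  surely on \<open>E\<close>.\<close>

lemma subgaussian_upper_tail_on_event:
  assumes M: "prob_space M" and S[measurable]: "S \<in> borel_measurable M" and E[measurable]: "E \<in> sets M"
    and mgf: "\<And>s. (\<integral>\<^sup>+\<omega>. indicator E \<omega> * ennreal (exp (s * S \<omega>)) \<partial>M) \<le> ennreal (exp (s\<^sup>2 * V / 2)) * emeasure M E"
    and V: "V \<ge> 0" and a: "a \<ge> 1"
  shows "measure M {\<omega> \<in> space M. \<omega> \<in> E \<and> sqrt (2 * V * ln a) < S \<omega>} \<le> 1 / a * measure M E"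
proof (cases "V = 0")
  case False
  interpret prob_space M by fact
  \<comment> \<open>The Chernoff exponent is minimal at \<open>s = ?t / V\<close>, where it equals
    \<open>- (?t\<^sup>2 / (2 * V)) = - ln a\<close>.\<close>
  let ?t = "sqrt (2 * V * ln a)"
  have t2: "?t\<^sup>2 = 2 * V * ln a" using V a by simp
  have "measure M {\<omega> \<in> space M. \<omega> \<in> E \<and> ?t < S \<omega>} \<le> measure M {\<omega> \<in> space M. \<omega> \<in> E \<and> ?t \<le> S \<omega>}"
    by (intro finite_measure_mono) auto
  also have "\<dots> \<le> exp ((?t / V)\<^sup>2 * V / 2 - (?t / V) * ?t) * measure M E"
    using V a by (intro chernoff_on_event[OF M S E mgf]) auto
  also have "(?t / V)\<^sup>2 * V / 2 - (?t / V) * ?t = - (?t\<^sup>2 / (2 * V))"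
    using False by (simp add: field_simps power2_eq_square)
  also have "\<dots> = - ln a" unfolding t2 using False by simp
  also have "exp (- ln a) = 1 / a" using a by (simp add: exp_minus divide_inverse)
  finally show ?thesis .
next
  case True
  interpret prob_space M by fact
  \<comment> \<open>With \<open>V = 0\<close> nothing limits \<open>s\<close>: at the level
    \<open>1 / real (Suc k)\<close> the choice \<open>s = real m\<close> gives a bound that tends to
    \<open>0\<close> with growing \<open>m\<close>. These levels exhaust the event
    \<open>0 < S \<omega>\<close>.\<close>
  have z: "measure M {\<omega> \<in> space M. \<omega> \<in> E \<and> 1 / real (Suc k) \<le> S \<omega>} = 0" for k
  proof -
    let ?P = "measure M {\<omega> \<in> space M. \<omega> \<in> E \<and> 1 / real (Suc k) \<le> S \<omega>}"
    have "?P \<le> exp (- real m / real (Suc k))" for m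
    proof -
      have "?P \<le> exp ((real m)\<^sup>2 * V / 2 - real m * (1 / real (Suc k))) * measure M E"
        by (intro chernoff_on_event[OF M S E mgf]) auto
      also have "\<dots> \<le> exp ((real m)\<^sup>2 * V / 2 - real m * (1 / real (Suc k))) * 1"
        by (intro mult_left_mono) auto
      finally show ?thesis using True by simp
    qed
    moreover have "(\<lambda>m. exp (- real m / real (Suc k))) \<longlonglongrightarrow> 0"
      by real_asymp
    ultimately have "?P \<le> 0" by (intro LIMSEQ_le_const) auto
    then show ?thesis by (simp add: measure_le_0_iff)
  qed
  have "{\<omega> \<in> space M. \<omega> \<in> E \<and> 0 < S \<omega>} = (\<Union>k. {\<omega> \<in> space M. \<omega> \<in> E \<and> 1 / real (Suc k) \<le> S \<omega>})"
  proof safe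
    fix \<omega> assume "\<omega> \<in> space M" "\<omega> \<in> E" "0 < S \<omega>"
    then obtain k where "inverse (real (Suc k)) < S \<omega>" using reals_Archimedean by blast
    then show "\<omega> \<in> (\<Union>k. {\<omega> \<in> space M. \<omega> \<in> E \<and> 1 / real (Suc k) \<le> S \<omega>})"
      using \<open>\<omega> \<in> space M\<close> \<open>\<omega> \<in> E\<close> by (auto simp: inverse_eq_divide intro!: exI[of _ k])
  next
    fix \<omega> k assume "1 / real (Suc k) \<le> S \<omega>"
    moreover have "0 < 1 / real (Suc k)" by simp
    ultimately show "0 < S \<omega>" by linarith
  qed
  also have "\<dots> \<in> null_sets M"
    by (intro null_sets_UN) (use z in \<open>auto simp: null_sets_def emeasure_eq_measure simp del: of_nat_Suc\<close>)
  finally have "measure M {\<omega> \<in> space M. \<omega> \<in> E \<and> 0 < S \<omega>} = 0"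
    by (simp add: null_sets_def measure_def)
  then show ?thesis using True a by simp
qed

lemma subgaussian_tail_on_event:
  assumes M: "prob_space M" and S[measurable]: "S \<in> borel_measurable M" and E[measurable]: "E \<in> sets M"
    and mgf: "\<And>s. (\<integral>\<^sup>+\<omega>. indicator E \<omega> * ennreal (exp (s * S \<omega>)) \<partial>M) \<le> ennreal (exp (s\<^sup>2 * V / 2)) * emeasure M E"
    and V: "V \<ge> 0" and a: "a \<ge> 1"
  shows "measure M {\<omega> \<in> space M. \<omega> \<in> E \<and> sqrt (2 * V * ln a) < \<bar>S \<omega>\<bar>} \<le> 2 / a * measure M E"
proof -
  interpret prob_space M by fact
  let ?t = "sqrt (2 * V * ln a)"
  have 1: "measure M {\<omega> \<in> space M. \<omega> \<in> E \<and> ?t < S \<omega>} \<le> 1 / a * measure M E"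
    by (rule subgaussian_upper_tail_on_event[OF assms])
  have "(\<integral>\<^sup>+\<omega>. indicator E \<omega> * ennreal (exp (s * - S \<omega>)) \<partial>M) \<le> ennreal (exp (s\<^sup>2 * V / 2)) * emeasure M E" for s
    using mgf[of "- s"] by simp
  then have 2: "measure M {\<omega> \<in> space M. \<omega> \<in> E \<and> ?t < - S \<omega>} \<le> 1 / a * measure M E"
    by (intro subgaussian_upper_tail_on_event[OF M _ E _ V a]) auto
  have "measure M {\<omega> \<in> space M. \<omega> \<in> E \<and> ?t < \<bar>S \<omega>\<bar>}
      \<le> measure M ({\<omega> \<in> space M. \<omega> \<in> E \<and> ?t < S \<omega>} \<union> {\<omega> \<in> space M. \<omega> \<in> E \<and> ?t < - S \<omega>})"
    by (intro finite_measure_mono) auto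
  also have "\<dots> \<le> measure M {\<omega> \<in> space M. \<omega> \<in> E \<and> ?t < S \<omega>} + measure M {\<omega> \<in> space M. \<omega> \<in> E \<and> ?t < - S \<omega>}"
    by (intro measure_Un_le) auto
  finally show ?thesis using 1 2 by (simp add: field_simps)
qed

text \<open>Measurability is asked of \<open>Q\<close> and of the conjunction: the intended
  \<open>P\<close> concerns the least squares estimator, which is shown to be measurable only on the
  design event \<open>Q\<close>.\<close>

lemma (in prob_space) cond_prob_ge_of_exception:
  assumes P: "{\<omega> \<in> space M. Q \<omega> \<and> P \<omega>} \<in> events" and Q: "{\<omega> \<in> space M. Q \<omega>} \<in> events"
    and ex: "\<P>(\<omega> in M. Q \<omega> \<and> \<not> P \<omega>) \<le> \<delta> * \<P>(\<omega> in M. Q \<omega>)" and pos: "\<P>(\<omega> in M. Q \<omega>) > 0"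
  shows "\<P>(\<omega> in M. P \<omega> \<bar> Q \<omega>) \<ge> 1 - \<delta>"
proof -
  have "{\<omega> \<in> space M. Q \<omega> \<and> \<not> P \<omega>} = {\<omega> \<in> space M. Q \<omega>} - {\<omega> \<in> space M. Q \<omega> \<and> P \<omega>}" by auto
  then have "\<P>(\<omega> in M. Q \<omega> \<and> \<not> P \<omega>) = \<P>(\<omega> in M. Q \<omega>) - \<P>(\<omega> in M. Q \<omega> \<and> P \<omega>)"
    using P Q by (simp add: finite_measure_Diff subset_eq)
  then have "(1 - \<delta>) * \<P>(\<omega> in M. Q \<omega>) \<le> \<P>(\<omega> in M. P \<omega> \<and> Q \<omega>)"
    using ex by (simp add: algebra_simps conj_commute)
  then show ?thesis using pos by (simp add: cond_prob_def field_simps)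
qed

section \<open>Ordinary least squares on the design event\<close>

lemma outer_product_mult_vec: "outer_product v *v x = (v \<bullet> x) *\<^sub>R v"
  by (vector outer_product_def matrix_vector_mult_def inner_vec_def sum_distrib_right sum_distrib_left
      mult_ac)

lemma sum_matrix_vector_mult: "(\<Sum>i\<in>I. B i) *v x = (\<Sum>i\<in>I. B i *v x)"
  for B :: "'i \<Rightarrow> real ^ 'n ^ 'm"
  by (induction I rule: infinite_finite_induct) (auto simp: matrix_vector_mult_add_rdistrib)

lemma sum_outer_product_eq_scaleR_gram:
  "n \<ge> 1 \<Longrightarrow> (\<Sum>i = 1..n. outer_product (z i)) = real n *\<^sub>R gram n z"
  by (simp add: gram_def)

text \<open>The Loewner bound says that the quadratic form at \<open>v\<close> is at least
  \<open>lam * (norm v)\<^sup>2\<close>, and Cauchy-Schwarz turns this into a lower bound for the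
  image of \<open>v\<close>. Injectivity and the bound on the inverse both follow, without any
  spectral theory.\<close>

lemma norm_gram_sum_mult_ge:
  assumes "loewner_ge (gram n z) (lam *\<^sub>R mat 1)" and "n \<ge> 1"
  shows "real n * lam * norm v \<le> norm ((\<Sum>i = 1..n. outer_product (z i)) *v v)"
proof -
  let ?G = "gram n z"
  have "0 \<le> v \<bullet> ((?G - lam *\<^sub>R mat 1) *v v)"
    using assms by (simp add: loewner_ge_def pos_semidef_def)
  then have "lam * (norm v)\<^sup>2 \<le> v \<bullet> (?G *v v)"
    by (simp add: matrix_vector_mult_diff_rdistrib inner_diff_right dot_square_norm
        flip: scaleR_matrix_vector_assoc)
  also have "\<dots> \<le> norm v * norm (?G *v v)" by (rule norm_cauchy_schwarz)
  finally have "lam * norm v \<le> norm (?G *v v)"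
    by (cases "v = 0") (auto simp: power2_eq_square algebra_simps)
  then show ?thesis using assms(2)
    unfolding sum_outer_product_eq_scaleR_gram[OF assms(2)]
    by (simp add: mult.assoc flip: scaleR_matrix_vector_assoc)
qed

lemma invertible_gram_sum:
  assumes "loewner_ge (gram n z) (lam *\<^sub>R mat 1)" and "n \<ge> 1" and "lam > 0"
  shows "invertible (\<Sum>i = 1..n. outer_product (z i))"
  unfolding invertible_left_inverse matrix_left_invertible_ker
proof (intro allI impI)
  fix v assume "(\<Sum>i = 1..n. outer_product (z i)) *v v = 0"
  then have "real n * lam * norm v \<le> 0" using norm_gram_sum_mult_ge[OF assms(1,2), of v] by simp
  then show "v = 0" using assms by (simp add: mult_le_0_iff)
qed

text \<open>The normal equations. \<open>matrix_inv\<close> is a Hilbert choice, and invertibility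
  on the design event guarantees that the chosen matrix is an inverse.\<close>

lemma gram_sum_mult_ols:
  assumes "loewner_ge (gram n z) (lam *\<^sub>R mat 1)" and "n \<ge> 1" and "lam > 0"
  shows "(\<Sum>i = 1..n. outer_product (z i)) *v ols n z y = (\<Sum>i = 1..n. y i *\<^sub>R z i)"
  unfolding ols_def matrix_vector_mul_assoc
  using someI_ex[OF invertible_gram_sum[OF assms, unfolded invertible_def]]
  by (simp add: matrix_inv_def)

text \<open>Purely deterministic: the Gram sum maps the estimation error to the sum of the
  \<open>e i *\<^sub>R z i\<close>. Bounding each coordinate of that sum by \<open>t\<close> bounds
  its norm by \<open>sqrt (real CARD('p)) * t\<close>.\<close>

lemma norm_ols_error_le:
  fixes z :: "nat \<Rightarrow> real ^ 'p"
  assumes d: "loewner_ge (gram n z) (lam *\<^sub>R mat 1)" and n: "n \<ge> 1" and lam: "lam > 0"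
    and y: "\<And>i. i \<in> {1..n} \<Longrightarrow> y i = z i \<bullet> w + e i"
    and t: "\<And>j. \<bar>\<Sum>i = 1..n. z i $ j * e i\<bar> \<le> t"
  shows "norm (ols n z y - w) \<le> sqrt (real CARD('p)) * t / (real n * lam)"
proof -
  let ?Q = "\<Sum>i = 1..n. outer_product (z i)" and ?S = "\<Sum>i = 1..n. e i *\<^sub>R z i"
  \<comment> \<open>Any coordinate would do; \<open>undefined\<close> merely names one.\<close>
  have t0: "0 \<le> t" using t[of undefined] by linarith
  have "(\<Sum>i = 1..n. y i *\<^sub>R z i) = ?Q *v w + ?S"
    by (simp add: y sum_matrix_vector_mult outer_product_mult_vec scaleR_add_left sum.distrib)
  then have S: "?Q *v (ols n z y - w) = ?S"
    using gram_sum_mult_ols[OF d n lam, of y] by (simp add: matrix_vector_mult_diff_distrib)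
  have "(norm ?S)\<^sup>2 = (\<Sum>j\<in>UNIV. (?S $ j)\<^sup>2)"
    by (simp add: norm_vec_def L2_set_def sum_nonneg)
  also have "\<dots> \<le> (\<Sum>j\<in>(UNIV :: 'p set). t\<^sup>2)"
  proof (rule sum_mono)
    fix j
    have "\<bar>?S $ j\<bar> \<le> t" using t[of j] by (simp add: mult.commute)
    then show "(?S $ j)\<^sup>2 \<le> t\<^sup>2" by (metis abs_ge_zero power2_abs power_mono)
  qed
  also have "\<dots> = (sqrt (real CARD('p)) * t)\<^sup>2" by (simp add: power_mult_distrib)
  finally have "norm ?S \<le> sqrt (real CARD('p)) * t" by (rule power2_le_imp_le) (simp add: t0)
  then have "real n * lam * norm (ols n z y - w) \<le> sqrt (real CARD('p)) * t"
    using norm_gram_sum_mult_ge[OF d n, of "ols n z y - w"] S by simp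
  then show ?thesis using n lam by (simp add: field_simps)
qed

section \<open>Measurability of the design event and of the estimation error on it\<close>

lemma borel_measurable_vec_iff:
  fixes f :: "'a \<Rightarrow> real ^ 'n"
  shows "f \<in> borel_measurable M \<longleftrightarrow> (\<forall>j. (\<lambda>x. f x $ j) \<in> borel_measurable M)"
  by (auto simp: borel_measurable_euclidean_space[of f] Basis_vec_def inner_axis)

text \<open>Symmetry and, for each \<open>v\<close>, nonnegativity of the quadratic form are closed
  conditions. Closedness survives the uncountable intersection over \<open>v\<close>, which
  measurability alone would not.\<close>

lemma closed_loewner_ge: "closed {S :: real ^ 'p ^ 'p. loewner_ge S T}"
proof -
  have "{S. loewner_ge S T} = {S. transpose (S - T) = S - T} \<inter> (\<Inter>v. {S. 0 \<le> v \<bullet> ((S - T) *v v)})"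
    by (auto simp: loewner_ge_def pos_semidef_def)
  moreover have "closed {S :: real ^ 'p ^ 'p. transpose (S - T) = S - T}"
    unfolding transpose_def
    by (intro closed_Collect_eq continuous_intros)
  moreover have "closed {S :: real ^ 'p ^ 'p. 0 \<le> v \<bullet> ((S - T) *v v)}" for v
    unfolding matrix_vector_mult_def inner_vec_def
    by (intro closed_Collect_le continuous_intros)
  ultimately show ?thesis by (simp add: closed_Int closed_INT)
qed

lemma borel_measurable_outer_product:
  assumes "z \<in> borel_measurable M"
  shows "(\<lambda>\<omega>. outer_product (z \<omega> :: real ^ 'p)) \<in> borel_measurable M"
proof -
  have "continuous_on UNIV (outer_product :: real ^ 'p \<Rightarrow> _)"
    unfolding outer_product_def by (intro continuous_intros)
  from borel_measurable_continuous_on[OF this assms] show ?thesis .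
qed

lemma sets_design:
  fixes z :: "nat \<Rightarrow> 'a \<Rightarrow> real ^ 'p"
  assumes "\<And>i. i \<in> {1..n} \<Longrightarrow> z i \<in> borel_measurable M"
  shows "{\<omega> \<in> space M. loewner_ge (gram n (\<lambda>i. z i \<omega>)) T} \<in> sets M"
proof -
  have "(\<lambda>\<omega>. gram n (\<lambda>i. z i \<omega>)) \<in> borel_measurable M"
    unfolding gram_def using assms
    by (intro borel_measurable_scaleR borel_measurable_const borel_measurable_sum
        borel_measurable_outer_product)
  from measurable_sets[OF this borel_closed[OF closed_loewner_ge[of T]]]
  show ?thesis by (simp add: vimage_def Int_def conj_commute)
qed

text \<open>
  On the design event the estimator agrees with the one given by Cramer's rule, which unlike
  \<^const>\<open>matrix_inv\<close> is visibly measurable.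
\<close>

lemma sets_design_ols:
  fixes z :: "nat \<Rightarrow> 'a \<Rightarrow> real ^ 'p"
  assumes z: "\<And>i. i \<in> {1..n} \<Longrightarrow> z i \<in> borel_measurable M"
    and y: "\<And>i. i \<in> {1..n} \<Longrightarrow> y i \<in> borel_measurable M"
    and n: "n \<ge> 1" and lam: "lam > 0"
  shows "{\<omega> \<in> space M. loewner_ge (gram n (\<lambda>i. z i \<omega>)) (lam *\<^sub>R mat 1)
    \<and> norm (ols n (\<lambda>i. z i \<omega>) (\<lambda>i. y i \<omega>) - w) \<le> r} \<in> sets M"
proof -
  define Q where "Q \<omega> = (\<Sum>i = 1..n. outer_product (z i \<omega>))" for \<omega>
  define b where "b \<omega> = (\<Sum>i = 1..n. y i \<omega> *\<^sub>R z i \<omega>)" for \<omega>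
  define x where "x \<omega> = (\<chi> k. det (\<chi> i j. if j = k then b \<omega> $ i else Q \<omega> $ i $ j) / det (Q \<omega>))" for \<omega>
  have Q: "Q \<in> borel_measurable M" unfolding Q_def
    using z by (intro borel_measurable_sum borel_measurable_outer_product)
  have b: "b \<in> borel_measurable M" unfolding b_def
    using z y by (intro borel_measurable_sum borel_measurable_scaleR)
  have Qij: "(\<lambda>\<omega>. Q \<omega> $ i $ j) \<in> borel_measurable M" for i j
  proof -
    have "continuous_on UNIV (\<lambda>S :: real ^ 'p ^ 'p. S $ i $ j)" by (intro continuous_intros)
    from borel_measurable_continuous_on[OF this Q] show ?thesis .
  qed
  have bi: "(\<lambda>\<omega>. b \<omega> $ i) \<in> borel_measurable M" for i
    using b by (simp add: borel_measurable_vec_iff)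
  have entry: "(\<lambda>\<omega>. if j = k then b \<omega> $ i else Q \<omega> $ i $ j) \<in> borel_measurable M" for i j k
    using Qij bi by (cases "j = k") auto
  have "x \<in> borel_measurable M"
    unfolding x_def borel_measurable_vec_iff det_def
    using Qij entry
    by (auto intro!: borel_measurable_divide borel_measurable_sum borel_measurable_times
        borel_measurable_prod)
  then have "{\<omega> \<in> space M. norm (x \<omega> - w) \<le> r} \<in> sets M"
    by measurable
  then have "{\<omega> \<in> space M. loewner_ge (gram n (\<lambda>i. z i \<omega>)) (lam *\<^sub>R mat 1)} \<inter>
      {\<omega> \<in> space M. norm (x \<omega> - w) \<le> r} \<in> sets M"
    using sets_design[OF z] by (intro sets.Int) auto
  also have "{\<omega> \<in> space M. loewner_ge (gram n (\<lambda>i. z i \<omega>)) (lam *\<^sub>R mat 1)} \<inter>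
      {\<omega> \<in> space M. norm (x \<omega> - w) \<le> r} =
    {\<omega> \<in> space M. loewner_ge (gram n (\<lambda>i. z i \<omega>)) (lam *\<^sub>R mat 1)
      \<and> norm (ols n (\<lambda>i. z i \<omega>) (\<lambda>i. y i \<omega>) - w) \<le> r}"
  proof -
    have "ols n (\<lambda>i. z i \<omega>) (\<lambda>i. y i \<omega>) = x \<omega>"
      if "loewner_ge (gram n (\<lambda>i. z i \<omega>)) (lam *\<^sub>R mat 1)" for \<omega>
      unfolding x_def
      using gram_sum_mult_ols[OF that n lam] invertible_gram_sum[OF that n lam]
      by (subst cramer[symmetric]) (auto simp: Q_def b_def invertible_det_nz)
    then show ?thesis by auto
  qed
  finally show ?thesis .
qed

section \<open>Deployment risk\<close>

text \<open>Working in \<open>ennreal\<close> makes finiteness of the second moment part of the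
  conclusion; square integrability of the outcome noise is derived from it.\<close>

lemma nn_integral_square_cond_centered:
  assumes sf: "sigma_finite_subalgebra M F" and prob: "prob_space M"
    and c: "cond_centered M F \<sigma> \<xi>"
  shows "(\<integral>\<^sup>+\<omega>. ennreal ((\<xi> \<omega>)\<^sup>2) \<partial>M) = ennreal (\<sigma>\<^sup>2)"
proof -
  interpret sigma_finite_subalgebra M F by fact
  interpret prob_space M by fact
  have [measurable]: "\<xi> \<in> borel_measurable M" using c by (auto simp: cond_centered_def)
  have z: "AE \<omega> in M. real_cond_exp M F \<xi> \<omega> = 0"
    and v: "AE \<omega> in M. cond_variance M F \<xi> \<omega> = ennreal (\<sigma>\<^sup>2)"
    using c by (auto simp: cond_centered_def)
  \<comment> \<open>The factor \<open>1\<close> is the \<open>F\<close>-measurable weight in the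
    characteristic identity of the conditional expectation.\<close>
  have "(\<integral>\<^sup>+\<omega>. ennreal ((\<xi> \<omega>)\<^sup>2) \<partial>M) = (\<integral>\<^sup>+\<omega>. 1 * ennreal ((\<xi> \<omega> - real_cond_exp M F \<xi> \<omega>)\<^sup>2) \<partial>M)"
    by (rule nn_integral_cong_AE) (use z in eventually_elim, simp)
  also have "\<dots> = (\<integral>\<^sup>+\<omega>. 1 * cond_variance M F \<xi> \<omega> \<partial>M)"
    unfolding cond_variance_def by (rule nn_cond_exp_intg[symmetric]) measurable
  also have "\<dots> = (\<integral>\<^sup>+\<omega>. ennreal (\<sigma>\<^sup>2) \<partial>M)"
    by (rule nn_integral_cong_AE) (use v in eventually_elim, simp)
  finally show ?thesis by (simp add: emeasure_space_1)
qed

text \<open>The bias-variance decomposition. The cross term vanishes since the prediction error is a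
  function of \<open>H\<close>, while the noise is centered given the \<sigma>-algebra generated by
  \<open>H\<close>.\<close>

lemma oracle_risk_eq_mean_risk:
  assumes D: "prob_space D" and H: "H \<in> measurable D HS"
    and zp: "zp \<in> borel_measurable HS" and f: "f \<in> borel_measurable HS"
    and c: "cond_centered D (vimage_algebra (space D) H HS) \<sigma> \<xi>"
    and B: "AE h in distr D HS H. \<bar>f h - zp h \<bullet> w\<bar> \<le> B"
  shows "oracle_risk D H \<xi> zp w f = mean_risk (distr D HS H) \<sigma> zp w f"
proof -
  interpret prob_space D by fact
  let ?F = "vimage_algebra (space D) H HS"
  have sub: "subalgebra D ?F"
    unfolding subalgebra_def using sets_image_in_sets[OF refl H] by simp
  note sf = prob_space_sigma_finite_subalgebraI[OF D sub]
  interpret sigma_finite_subalgebra D ?F by (rule sf)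
  define g where "g h = f h - zp h \<bullet> w" for h
  have g: "g \<in> borel_measurable HS" unfolding g_def using f zp by measurable
  have HF: "H \<in> measurable ?F HS"
    using H by (intro measurable_vimage_algebra1) (auto simp: measurable_def)
  have gF[measurable]: "(\<lambda>\<omega>. g (H \<omega>)) \<in> borel_measurable ?F" by (rule measurable_compose[OF HF g])
  have gD[measurable]: "(\<lambda>\<omega>. g (H \<omega>)) \<in> borel_measurable D" by (rule measurable_compose[OF H g])
  have bd: "AE \<omega> in D. \<bar>g (H \<omega>)\<bar> \<le> B" using AE_distrD[OF H B] by (simp add: g_def)
  have \<xi>: "integrable D \<xi>" and ce: "AE \<omega> in D. real_cond_exp D ?F \<xi> \<omega> = 0"
    using c by (auto simp: cond_centered_def)
  have [measurable]: "\<xi> \<in> borel_measurable D" using \<xi> by auto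
  have sq: "has_bochner_integral D (\<lambda>\<omega>. (\<xi> \<omega>)\<^sup>2) (\<sigma>\<^sup>2)"
    by (rule has_bochner_integral_nn_integral)
       (use nn_integral_square_cond_centered[OF sf D c] in auto)
  have gi: "integrable D (\<lambda>\<omega>. (g (H \<omega>))\<^sup>2)"
  proof (rule integrable_const_bound[of _ "B\<^sup>2"])
    show "AE \<omega> in D. norm ((g (H \<omega>))\<^sup>2) \<le> B\<^sup>2"
      using bd by eventually_elim (simp add: abs_le_square_iff[symmetric])
  qed measurable
  \<comment> \<open>Boundedness of the prediction error transfers integrability from
    \<open>\<xi>\<close> to the product, so that the first factor may be pulled out of the
    conditional expectation.\<close>
  have gx: "integrable D (\<lambda>\<omega>. g (H \<omega>) * \<xi> \<omega>)"
  proof (rule Bochner_Integration.integrable_bound)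
    show "integrable D (\<lambda>\<omega>. B * \<xi> \<omega>)" using \<xi> by simp
    show "AE \<omega> in D. norm (g (H \<omega>) * \<xi> \<omega>) \<le> norm (B * \<xi> \<omega>)"
      using bd by eventually_elim (auto simp: abs_mult intro!: mult_right_mono)
  qed measurable
  have "(\<integral>\<omega>. g (H \<omega>) * \<xi> \<omega> \<partial>D) = (\<integral>\<omega>. g (H \<omega>) * real_cond_exp D ?F \<xi> \<omega> \<partial>D)"
    by (rule real_cond_exp_intg(2)[OF gx, symmetric]) measurable
  also have "\<dots> = (\<integral>\<omega>. 0 \<partial>D)"
  proof (rule integral_cong_AE)
    show "AE \<omega> in D. g (H \<omega>) * real_cond_exp D ?F \<xi> \<omega> = 0"
      using ce by eventually_elim simp
  qed measurable
  finally have cross: "(\<integral>\<omega>. g (H \<omega>) * \<xi> \<omega> \<partial>D) = 0" by simp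
  have "oracle_risk D H \<xi> zp w f = (\<integral>\<omega>. (g (H \<omega>))\<^sup>2 - 2 * (g (H \<omega>) * \<xi> \<omega>) + (\<xi> \<omega>)\<^sup>2 \<partial>D)"
    unfolding oracle_risk_def g_def
    by (rule Bochner_Integration.integral_cong) (auto simp: power2_eq_square algebra_simps)
  also have "\<dots> = (\<integral>\<omega>. (g (H \<omega>))\<^sup>2 \<partial>D) + \<sigma>\<^sup>2"
    using gi gx sq cross by (simp add: has_bochner_integral_iff)
  also have "(\<integral>\<omega>. (g (H \<omega>))\<^sup>2 \<partial>D) = (\<integral>h. (g h)\<^sup>2 \<partial>distr D HS H)"
    using g by (intro integral_distr[OF H, symmetric]) measurable
  finally show ?thesis by (simp add: mean_risk_def g_def)
qed

text \<open>With \<open>g\<close> the oracle prediction error and \<open>d\<close> the shift of the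
  conditional mean, \<open>(g - d)\<^sup>2 - g\<^sup>2 = d\<^sup>2 - 2 * (g * d)\<close>, and the
  right-hand side is almost surely bounded by \<open>2 * B * e + e\<^sup>2\<close>. The vector
  \<open>v\<close> is fixed, as the estimate is under the deployment expectation.\<close>

lemma mean_risk_perturbation:
  assumes P: "prob_space P"
    and zp[measurable]: "zp \<in> borel_measurable P" and f[measurable]: "f \<in> borel_measurable P"
    and B: "AE h in P. \<bar>f h - zp h \<bullet> w\<bar> \<le> B"
    and e: "AE h in P. \<bar>zp h \<bullet> (v - w)\<bar> \<le> e"
  shows "\<bar>mean_risk P \<sigma> zp v f - mean_risk P \<sigma> zp w f\<bar> \<le> 2 * B * e + e\<^sup>2"
proof -
  interpret prob_space P by fact
  let ?g = "\<lambda>h. f h - zp h \<bullet> w" and ?d = "\<lambda>h. zp h \<bullet> (v - w)"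
  have gi: "integrable P (\<lambda>h. (?g h)\<^sup>2)"
  proof (rule integrable_const_bound[of _ "B\<^sup>2"])
    show "AE h in P. norm ((?g h)\<^sup>2) \<le> B\<^sup>2"
      using B by eventually_elim (simp add: abs_le_square_iff[symmetric])
  qed measurable
  have le: "AE h in P. \<bar>(?d h)\<^sup>2 - 2 * (?g h * ?d h)\<bar> \<le> 2 * B * e + e\<^sup>2"
    using B e
  proof eventually_elim
    case (elim h)
    have "(?d h)\<^sup>2 \<le> e\<^sup>2" using elim by (simp add: abs_le_square_iff[symmetric])
    \<comment> \<open>That \<open>B\<close> is nonnegative is read off at the point
      \<open>h\<close>, where it dominates an absolute value.\<close>
    moreover have "\<bar>?g h * ?d h\<bar> \<le> B * e"
      unfolding abs_mult using elim by (intro mult_mono) auto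
    moreover have "\<bar>a - 2 * b\<bar> \<le> \<bar>a\<bar> + 2 * \<bar>b\<bar>" for a b :: real by linarith
    then have "\<bar>(?d h)\<^sup>2 - 2 * (?g h * ?d h)\<bar> \<le> (?d h)\<^sup>2 + 2 * \<bar>?g h * ?d h\<bar>"
      by (metis abs_power2)
    ultimately show ?case by linarith
  qed
  have di: "integrable P (\<lambda>h. (?d h)\<^sup>2 - 2 * (?g h * ?d h))"
    by (rule integrable_const_bound[of _ "2 * B * e + e\<^sup>2"]) (use le in auto)
  have "(\<integral>h. (f h - zp h \<bullet> v)\<^sup>2 \<partial>P) = (\<integral>h. (?g h)\<^sup>2 + ((?d h)\<^sup>2 - 2 * (?g h * ?d h)) \<partial>P)"
    by (rule Bochner_Integration.integral_cong)
       (auto simp: power2_eq_square algebra_simps inner_diff_right)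
  also have "\<dots> = (\<integral>h. (?g h)\<^sup>2 \<partial>P) + (\<integral>h. (?d h)\<^sup>2 - 2 * (?g h * ?d h) \<partial>P)"
    by (rule Bochner_Integration.integral_add[OF gi di])
  finally have "mean_risk P \<sigma> zp v f - mean_risk P \<sigma> zp w f = (\<integral>h. (?d h)\<^sup>2 - 2 * (?g h * ?d h) \<partial>P)"
    by (simp add: mean_risk_def)
  also have "\<bar>\<dots>\<bar> \<le> (\<integral>h. \<bar>(?d h)\<^sup>2 - 2 * (?g h * ?d h)\<bar> \<partial>P)" by (rule integral_abs_bound)
  also have "\<dots> \<le> (\<integral>h. 2 * B * e + e\<^sup>2 \<partial>P)"
    by (rule integral_mono_AE) (use di le in auto)
  also have "\<dots> = 2 * B * e + e\<^sup>2" by (simp add: prob_space)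
  finally show ?thesis .
qed

text \<open>The quantifiers over policies, forecasters and outcome noise stand inside
  \<open>good\<close>, so one event serves them all. The features may depend on earlier noise, and
  conditioning on a design event outside \<open>F 0\<close> could bias that noise; the implication
  \<open>design \<omega> \<longrightarrow> good \<omega>\<close> avoids conditioning.\<close>

theorem theorem3:
  fixes M :: "'a measure" and F :: "nat \<Rightarrow> 'a measure"
    and \<phi> :: "nat \<Rightarrow> 'a \<Rightarrow> 'p::finite \<Rightarrow> real" and A :: "nat \<Rightarrow> 'a \<Rightarrow> real"
    and z :: "nat \<Rightarrow> 'a \<Rightarrow> real ^ 'p" and Y \<epsilon> :: "nat \<Rightarrow> 'a \<Rightarrow> real"
    and act :: 'p and \<theta> :: "'p \<Rightarrow> real" and \<beta> :: real and w :: "real ^ 'p"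
    and n :: nat and L \<sigma> lam \<delta> :: real
    and D :: "'b measure" and HS :: "'h measure" and H :: "'b \<Rightarrow> 'h"
    and \<psi> :: "'h \<Rightarrow> 'p \<Rightarrow> real"
  assumes "prob_space M" and "n \<ge> 1" and "\<sigma> \<ge> 0" and "lam > 0" and "0 < \<delta>" and "\<delta> < 1"
    and "filtration (space M) F" and "\<And>i. subalgebra M (F i)"
    and "w = feature_action act \<theta> \<beta>"
    and "\<And>i \<omega>. z i \<omega> = feature_action act (\<phi> i \<omega>) (A i \<omega>)"
    and "\<And>i \<omega>. i \<in> {1..n} \<Longrightarrow> \<omega> \<in> space M \<Longrightarrow> Y i \<omega> = z i \<omega> \<bullet> w + \<epsilon> i \<omega>"
    and "\<And>i. i \<in> {1..n} \<Longrightarrow> AE \<omega> in M. norm (z i \<omega>) \<le> L"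
    and "\<And>i. i \<in> {1..n} \<Longrightarrow> z i \<in> borel_measurable (F (i - 1))"
    and "\<And>i. i \<in> {1..n} \<Longrightarrow> \<epsilon> i \<in> borel_measurable (F i)"
    and "\<And>i. i \<in> {1..n} \<Longrightarrow> cond_centered M (F (i - 1)) \<sigma> (\<epsilon> i)"
    and "\<And>i. i \<in> {1..n} \<Longrightarrow> cond_subgaussian M (F (i - 1)) \<sigma> (\<epsilon> i)"
    and "prob_space D" and "H \<in> measurable D HS"
  shows
    "let p = real CARD('p);
         P\<^sub>H = distr D HS H;
         w_hat = (\<lambda>\<omega>. ols n (\<lambda>i. z i \<omega>) (\<lambda>i. Y i \<omega>));
         design = (\<lambda>\<omega>. loewner_ge (gram n (\<lambda>i. z i \<omega>)) (lam *\<^sub>R mat 1));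
         r = \<sigma> * L / lam * sqrt (2 * p * ln (2 * p / \<delta>) / real n);
         eps = \<sigma> * L\<^sup>2 / lam * sqrt (2 * p * ln (2 * p / \<delta>) / real n);
         good = (\<lambda>\<omega>. norm (w_hat \<omega> - w) \<le> r \<and>
           (\<forall>\<pi> zp. zp = (\<lambda>h. feature_action act (\<psi> h) (\<pi> h)) \<and> zp \<in> borel_measurable HS
               \<and> (AE h in P\<^sub>H. norm (zp h) \<le> L) \<longrightarrow>
             (AE h in P\<^sub>H. \<bar>zp h \<bullet> (w_hat \<omega> - w)\<bar> \<le> eps) \<and>
             (\<forall>f \<xi> B. f \<in> borel_measurable HS
                 \<and> cond_centered D (vimage_algebra (space D) H HS) \<sigma> \<xi>
                 \<and> (AE h in P\<^sub>H. \<bar>f h - zp h \<bullet> w\<bar> \<le> B) \<longrightarrow>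
               oracle_risk D H \<xi> zp w f = mean_risk P\<^sub>H \<sigma> zp w f \<and>
               \<bar>mean_risk P\<^sub>H \<sigma> zp (w_hat \<omega>) f - oracle_risk D H \<xi> zp w f\<bar>
                 \<le> 2 * B * eps + eps\<^sup>2)))
     in \<P>(\<omega> in M. design \<omega> \<longrightarrow> good \<omega>) \<ge> 1 - \<delta>
        \<and> ({\<omega> \<in> space M. design \<omega>} \<in> sets (F 0) \<and> \<P>(\<omega> in M. design \<omega>) > 0 \<longrightarrow>
             \<P>(\<omega> in M. good \<omega> \<bar> design \<omega>) \<ge> 1 - \<delta>)"
proof -
  interpret prob_space M by fact
  define p where "p = real CARD('p)"
  define r where "r = \<sigma> * L / lam * sqrt (2 * p * ln (2 * p / \<delta>) / real n)"
  define eps where "eps = \<sigma> * L\<^sup>2 / lam * sqrt (2 * p * ln (2 * p / \<delta>) / real n)"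
  define P where "P = distr D HS H"
  define w_hat where "w_hat = (\<lambda>\<omega>. ols n (\<lambda>i. z i \<omega>) (\<lambda>i. Y i \<omega>))"
  define design where "design = (\<lambda>\<omega>. loewner_ge (gram n (\<lambda>i. z i \<omega>)) (lam *\<^sub>R mat 1))"
  note n = assms(2) and \<sigma> = assms(3) and lam = assms(4) and \<delta> = assms(5,6)
    and filt = assms(7) and subF = assms(8) and Y = assms(11) and zL = assms(12)
    and zF = assms(13) and \<epsilon>F = assms(14) and sub = assms(16) and H = assms(18)
  have p1: "p \<ge> 1" unfolding p_def by (simp add: Suc_leI)
  \<comment> \<open>Chosen so that a two-sided tail \<open>2 / a\<close> per coordinate is
    \<open>\<delta> / p\<close>; the \<open>p\<close> coordinates then add up to
    \<open>\<delta>\<close>.\<close>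
  define a where "a = 2 * p / \<delta>"
  have a1: "a \<ge> 1" unfolding a_def using p1 \<delta> by (simp add: field_simps)
  \<comment> \<open>The sign of \<open>L\<close> comes from the bound on the first observation,
    which exists as \<open>n \<ge> 1\<close>; an almost sure constant statement holds outright on a
    probability space.\<close>
  have L0: "0 \<le> L"
  proof -
    have "AE \<omega> in M. norm (z 1 \<omega>) \<le> L" using zL[of 1] n by simp
    then have "AE \<omega> in M. 0 \<le> L" by eventually_elim (meson norm_ge_zero order_trans)
    then show ?thesis by simp
  qed
  have eps: "eps = L * r" by (simp add: eps_def r_def power2_eq_square)
  have zM: "z i \<in> borel_measurable M" if "i \<in> {1..n}" for i
    by (rule measurable_from_subalg[OF subF zF[OF that]])
  have \<epsilon>M: "\<epsilon> i \<in> borel_measurable M" if "i \<in> {1..n}" for i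
    by (rule measurable_from_subalg[OF subF \<epsilon>F[OF that]])
  have YM: "Y i \<in> borel_measurable M" if "i \<in> {1..n}" for i
    using zM[OF that] \<epsilon>M[OF that]
    by (subst measurable_cong[OF Y[OF that]])
       (auto intro!: borel_measurable_add borel_measurable_inner)
  have designM: "{\<omega> \<in> space M. design \<omega>} \<in> events"
    unfolding design_def by (rule sets_design) (use zM in auto)
  have goodM: "{\<omega> \<in> space M. design \<omega> \<and> norm (w_hat \<omega> - w) \<le> r} \<in> events"
    unfolding design_def w_hat_def by (rule sets_design_ols) (use zM YM n lam in auto)

  define good where "good = (\<lambda>\<omega>. norm (w_hat \<omega> - w) \<le> r \<and>
           (\<forall>\<pi> zp. zp = (\<lambda>h. feature_action act (\<psi> h) (\<pi> h)) \<and> zp \<in> borel_measurable HS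
               \<and> (AE h in P. norm (zp h) \<le> L) \<longrightarrow>
             (AE h in P. \<bar>zp h \<bullet> (w_hat \<omega> - w)\<bar> \<le> eps) \<and>
             (\<forall>f \<xi> B. f \<in> borel_measurable HS
                 \<and> cond_centered D (vimage_algebra (space D) H HS) \<sigma> \<xi>
                 \<and> (AE h in P. \<bar>f h - zp h \<bullet> w\<bar> \<le> B) \<longrightarrow>
               oracle_risk D H \<xi> zp w f = mean_risk P \<sigma> zp w f \<and>
               \<bar>mean_risk P \<sigma> zp (w_hat \<omega>) f - oracle_risk D H \<xi> zp w f\<bar>
                 \<le> 2 * B * eps + eps\<^sup>2)))"
  have PP: "prob_space P"
    unfolding P_def by (rule prob_space.prob_space_distr[OF assms(17) H])
  \<comment> \<open>All deployment clauses follow from the norm bound for the same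
    \<open>\<omega>\<close>. Hence no union over policies is formed, and only the norm bound raises
    a question of measurability.\<close>
  have good_iff: "good \<omega> \<longleftrightarrow> norm (w_hat \<omega> - w) \<le> r" for \<omega>
  proof
    assume le: "norm (w_hat \<omega> - w) \<le> r"
    have est: "AE h in P. \<bar>zp h \<bullet> (w_hat \<omega> - w)\<bar> \<le> eps" if "AE h in P. norm (zp h) \<le> L" for zp
      using that
    proof eventually_elim
      case (elim h)
      have "\<bar>zp h \<bullet> (w_hat \<omega> - w)\<bar> \<le> norm (zp h) * norm (w_hat \<omega> - w)"
        by (rule Cauchy_Schwarz_ineq2)
      also have "\<dots> \<le> L * r" using elim le L0 by (intro mult_mono) auto
      finally show ?case by (simp add: eps)
    qed
    have risk: "oracle_risk D H \<xi> zp w f = mean_risk P \<sigma> zp w f \<and>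
        \<bar>mean_risk P \<sigma> zp (w_hat \<omega>) f - oracle_risk D H \<xi> zp w f\<bar> \<le> 2 * B * eps + eps\<^sup>2"
      if zp: "zp \<in> borel_measurable HS" "AE h in P. norm (zp h) \<le> L"
        and f: "f \<in> borel_measurable HS"
        and c: "cond_centered D (vimage_algebra (space D) H HS) \<sigma> \<xi>"
        and B: "AE h in P. \<bar>f h - zp h \<bullet> w\<bar> \<le> B" for zp f \<xi> B
    proof -
      have eq: "oracle_risk D H \<xi> zp w f = mean_risk P \<sigma> zp w f"
        unfolding P_def by (rule oracle_risk_eq_mean_risk[OF assms(17) H zp(1) f c B[unfolded P_def]])
      have "\<bar>mean_risk P \<sigma> zp (w_hat \<omega>) f - mean_risk P \<sigma> zp w f\<bar> \<le> 2 * B * eps + eps\<^sup>2"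
        by (rule mean_risk_perturbation[OF PP _ _ B est[OF zp(2)]]) (use zp f in \<open>auto simp: P_def\<close>)
      with eq show ?thesis by simp
    qed
    show "good \<omega>"
      unfolding good_def
      by (intro conjI le allI impI; elim conjE;
          (rule est | rule conjunct1[OF risk] | rule conjunct2[OF risk]); assumption)
  qed (simp add: good_def)

  define S where "S j \<omega> = (\<Sum>i = 1..n. z i \<omega> $ j * \<epsilon> i \<omega>)" for j \<omega>
  \<comment> \<open>The variance proxy of each coordinate of the score: \<open>n\<close> increments,
    each with multiplier at most \<open>L\<close> in absolute value.\<close>
  define V where "V = real n * (\<sigma>\<^sup>2 * L\<^sup>2)"
  define t where "t = sqrt (2 * V * ln a)"
  have SM[measurable]: "S j \<in> borel_measurable M" for j
    unfolding S_def using zM \<epsilon>M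
    by (intro borel_measurable_sum borel_measurable_times) (auto simp: borel_measurable_vec_iff)
  \<comment> \<open>Naming the square roots \<open>q\<close> and \<open>s\<close> leaves a rational
    identity; \<open>\<sigma>\<close> and \<open>L\<close> leave the root without absolute values
    because both are nonnegative.\<close>
  have r_eq: "sqrt p * t / (real n * lam) = r"
  proof -
    define q s where "q = sqrt (real n)" and "s = sqrt (2 * ln a)"
    have q: "real n = q * q" "q \<noteq> 0" unfolding q_def using n by auto
    have t: "t = \<sigma> * L * q * s"
      unfolding t_def V_def q_def s_def using \<sigma> L0 by (simp add: real_sqrt_mult)
    have r: "r = \<sigma> * L / lam * (sqrt p * s / q)"
      unfolding r_def a_def q_def s_def by (simp add: real_sqrt_mult real_sqrt_divide)
    show ?thesis unfolding q(1) r t using q(2) lam by (simp add: field_simps)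
  qed
  have le_r: "norm (w_hat \<omega> - w) \<le> r" if "\<omega> \<in> space M" "design \<omega>" "\<And>j. \<bar>S j \<omega>\<bar> \<le> t" for \<omega>
  proof -
    have "norm (w_hat \<omega> - w) \<le> sqrt (real CARD('p)) * t / (real n * lam)"
      unfolding w_hat_def
    proof (rule norm_ols_error_le[OF _ n lam])
      show "loewner_ge (gram n (\<lambda>i. z i \<omega>)) (lam *\<^sub>R mat 1)" using that(2) by (simp add: design_def)
      show "Y i \<omega> = z i \<omega> \<bullet> w + \<epsilon> i \<omega>" if "i \<in> {1..n}" for i by (rule Y[OF that \<open>\<omega> \<in> space M\<close>])
      show "\<bar>\<Sum>i = 1..n. z i \<omega> $ j * \<epsilon> i \<omega>\<bar> \<le> t" for j using that(3)[of j] by (simp only: S_def)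
    qed
    then show ?thesis using r_eq by (simp add: p_def)
  qed

  \<comment> \<open>Used twice: with \<open>E\<close> the whole space for the unconditional claim,
    and with \<open>E\<close> the design event for the conditional one.\<close>
  have key: "\<P>(\<omega> in M. \<omega> \<in> E \<and> design \<omega> \<and> \<not> norm (w_hat \<omega> - w) \<le> r) \<le> \<delta> * measure M E"
    if E0: "E \<in> sets (F 0)" for E
  proof -
    have E[measurable]: "E \<in> events" using subF[of 0] E0 by (auto simp: subalgebra_def)
    have tail: "\<P>(\<omega> in M. \<omega> \<in> E \<and> t < \<bar>S j \<omega>\<bar>) \<le> 2 / a * measure M E" for j
      unfolding t_def
    proof (rule subgaussian_tail_on_event[OF assms(1) SM E _ _ a1])
      show "(\<integral>\<^sup>+\<omega>. indicator E \<omega> * ennreal (exp (s * S j \<omega>)) \<partial>M) \<le> ennreal (exp (s\<^sup>2 * V / 2)) * emeasure M E" for s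
        unfolding S_def V_def
      proof (rule nn_integral_exp_predictable_sum_le[where n = n, OF assms(1) filt subF _ _ \<epsilon>F sub E0 order_refl])
        fix i assume i: "i \<in> {1..n}"
        show "AE \<omega> in M. \<bar>z i \<omega> $ j\<bar> \<le> L"
          using zL[OF i] by eventually_elim (meson component_le_norm_cart order_trans)
        show "(\<lambda>\<omega>. z i \<omega> $ j) \<in> borel_measurable (F (i - 1))"
          using zF[OF i] by (simp add: borel_measurable_vec_iff)
      qed
    qed (simp add: V_def)
    \<comment> \<open>On the design event a large error forces some coordinate of the score beyond
      \<open>t\<close>. Monotonicity asks for measurability of the larger set alone.\<close>
    have "\<P>(\<omega> in M. \<omega> \<in> E \<and> design \<omega> \<and> \<not> norm (w_hat \<omega> - w) \<le> r)
        \<le> measure M (\<Union>j. {\<omega> \<in> space M. \<omega> \<in> E \<and> t < \<bar>S j \<omega>\<bar>})"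
    proof (rule finite_measure_mono)
      show "{\<omega> \<in> space M. \<omega> \<in> E \<and> design \<omega> \<and> \<not> norm (w_hat \<omega> - w) \<le> r}
          \<subseteq> (\<Union>j. {\<omega> \<in> space M. \<omega> \<in> E \<and> t < \<bar>S j \<omega>\<bar>})"
        using le_r by (auto simp flip: not_le)
    qed auto
    also have "\<dots> \<le> (\<Sum>j\<in>UNIV. \<P>(\<omega> in M. \<omega> \<in> E \<and> t < \<bar>S j \<omega>\<bar>))"
      by (intro finite_measure_subadditive_finite) auto
    also have "\<dots> \<le> (\<Sum>j\<in>(UNIV :: 'p set). 2 / a * measure M E)"
      by (rule sum_mono) (rule tail)
    also have "\<dots> = \<delta> * measure M E"
      using p1 \<delta> by (simp add: a_def p_def)
    finally show ?thesis .
  qed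

  have "\<P>(\<omega> in M. design \<omega> \<longrightarrow> good \<omega>) \<ge> 1 - \<delta>"
  proof -
    have sp: "space M \<in> sets (F 0)" using filtration.space_F[OF filt, of 0] sets.top[of "F 0"] by simp
    \<comment> \<open>The exceptional set is measurable as a difference of two sets inside the
      design event, where the estimator is under control.\<close>
    let ?N = "{\<omega> \<in> space M. design \<omega> \<and> \<not> norm (w_hat \<omega> - w) \<le> r}"
    have "?N = {\<omega> \<in> space M. design \<omega>} - {\<omega> \<in> space M. design \<omega> \<and> norm (w_hat \<omega> - w) \<le> r}" by auto
    then have N: "?N \<in> events" using designM goodM by auto
    have "{\<omega> \<in> space M. design \<omega> \<longrightarrow> good \<omega>} = space M - ?N" by (auto simp: good_iff)
    then have "\<P>(\<omega> in M. design \<omega> \<longrightarrow> good \<omega>) = 1 - prob ?N" by (simp only: prob_compl[OF N])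
    moreover have "prob ?N \<le> \<delta>"
      using key[OF sp] by (simp add: prob_space)
    ultimately show ?thesis by simp
  qed
  moreover have "\<P>(\<omega> in M. good \<omega> \<bar> design \<omega>) \<ge> 1 - \<delta>"
    if d: "{\<omega> \<in> space M. design \<omega>} \<in> sets (F 0)" and pos: "\<P>(\<omega> in M. design \<omega>) > 0"
    unfolding good_iff
  proof (rule cond_prob_ge_of_exception[OF goodM designM _ pos])
    \<comment> \<open>With \<open>E\<close> the design event, membership in \<open>E\<close> repeats
      \<open>design \<omega>\<close>, and the factor \<open>measure M E\<close> is the probability
      conditioned on.\<close>
    have "{\<omega> \<in> space M. \<omega> \<in> {\<omega> \<in> space M. design \<omega>} \<and> design \<omega> \<and> \<not> norm (w_hat \<omega> - w) \<le> r}
      = {\<omega> \<in> space M. design \<omega> \<and> \<not> norm (w_hat \<omega> - w) \<le> r}" by auto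
    then show "\<P>(\<omega> in M. design \<omega> \<and> \<not> norm (w_hat \<omega> - w) \<le> r) \<le> \<delta> * \<P>(\<omega> in M. design \<omega>)"
      using key[OF d] by simp
  qed
  ultimately show ?thesis
    unfolding Let_def good_def design_def w_hat_def P_def eps_def r_def p_def
    by (intro conjI impI) (assumption | erule conjE)+
qed

end
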